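(* Let $d$ and $r$ be positive integers with $r\ge d+2$, and let $s$ be a sufficiently large integer relative to $d$ and $r$. Then there exists a constant $c_{d,r}>0$ (depending only on $d,r$) such that \[ F_r(d,s,\ldots,s)\le c_{d,r}\cdot\min\Big\{s^{\left(1-\frac{1}{2^{d}(d+1)}\right)r+1},\ s^{2d+3}\Big\}, \] where $s$ is repeated $r$ times.
   Context: For integers $d\ge1$, $r\ge2$ and $s_1,\ldots,s_r\ge1$, $F_r(d,s_1,\ldots,s_r)$ is the least integer $n$ such that every $n$-point set $P\subseteq\mathbb{R}^d$ admits a partition $P=P_1\sqcup\cdots\sqcup P_r$ with the following property: whenever, for each $i\in[r]$, $C_i=\bigcup_{j=1}^{s_i}C_{i,j}$ where the $C_{i,j}$ ($j\in[s_i]$) are convex sets with $C_{i,j}\cap C_{i,j'}=\emptyset$ for all $j\neq j'$, and $P_i\subseteq C_i$, then $\bigcap_{i=1}^r C_i\neq\emptyset$. *)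

theory Defs
  imports "HOL-Analysis.Analysis"
begin

text \<open>
  The indices \<open>i \<in> [r]\<close> and \<open>j \<in> [s\<^sub>i]\<close> range over \<open>{1..r}\<close> and \<open>{1..s i}\<close>;
  the values of \<open>s\<close>, \<open>Q\<close> and \<open>C\<close> at other indices are irrelevant.
  The convex sets \<open>C i j\<close> are arbitrary (not necessarily closed, bounded or nonempty).
\<close>

definition forces_intersection ::
    "nat \<Rightarrow> (nat \<Rightarrow> nat) \<Rightarrow> (nat \<Rightarrow> (real ^ 'd) set) \<Rightarrow> bool" where
  "forces_intersection r s Q \<longleftrightarrow>
     (\<forall>C :: nat \<Rightarrow> nat \<Rightarrow> (real ^ 'd) set.
        (\<forall>i\<in>{1..r}. (\<forall>j\<in>{1..s i}. convex (C i j)) \<and>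
                     disjoint_family_on (C i) {1..s i} \<and>
                     Q i \<subseteq> (\<Union>j\<in>{1..s i}. C i j))
        \<longrightarrow> (\<Inter>i\<in>{1..r}. \<Union>j\<in>{1..s i}. C i j) \<noteq> {})"

definition has_forcing_partition ::
    "nat \<Rightarrow> (nat \<Rightarrow> nat) \<Rightarrow> (real ^ 'd) set \<Rightarrow> bool" where
  "has_forcing_partition r s P \<longleftrightarrow>
     (\<exists>Q. P = (\<Union>i\<in>{1..r}. Q i) \<and> disjoint_family_on Q {1..r} \<and>
          forces_intersection r s Q)"

text \<open>
  The dimension \<open>d\<close> is \<open>CARD('d)\<close>, passed as a type argument.  The least \<open>n\<close> is taken
  in \<^typ>\<open>enat\<close>, where \<open>Inf {} = \<infinity>\<close>: a finite upper bound on \<open>F_number\<close> therefore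
  includes the assertion that some \<open>n\<close> with the required property exists.
\<close>

definition F_number :: "'d::finite itself \<Rightarrow> nat \<Rightarrow> (nat \<Rightarrow> nat) \<Rightarrow> enat" where
  "F_number _ r s =
     Inf {enat n | n. \<forall>P :: (real ^ 'd) set.
                        finite P \<and> card P = n \<longrightarrow> has_forcing_partition r s P}"

end

theory Submission imports Defs "HOL-Real_Asymp.Real_Asymp" begin

text \<open>
  A counting argument gives the stronger bound \<open>s ^ (d + 2)\<close> for all large \<open>s\<close>.  If a colouring of
  an \<open>n\<close>-point set \<open>P\<close> with \<open>r\<close> colours is not forcing, replace each convex set by the hull of the
  points of its colour that it contains.  By Helly, every choice of one hull per colour has an empty
  intersection witnessed by at most \<open>d + 1\<close> of the hulls, and these can be enlarged to halfspaces with
  empty intersection.  Hence \<open>O(s ^ (d + 1))\<close> halfspaces certify the failure.  By Sauer--Shelah and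
  Radon each has at most \<open>(n + 1) ^ (d + 1)\<close> traces on \<open>P\<close>.  For fixed traces, every point of \<open>P\<close>
  is denied at least one colour, so at most \<open>(r - 1) ^ n\<close> colourings share a certificate.  For
  \<open>n = s ^ (d + 2)\<close> this accounts for fewer than \<open>r ^ n\<close> colourings.
\<close>

section \<open>Shattered sets and the Sauer--Shelah bound\<close>

definition shatters :: "'a set set \<Rightarrow> 'a set \<Rightarrow> bool" where
  "shatters F A \<longleftrightarrow> (\<forall>B\<subseteq>A. \<exists>S\<in>F. S \<inter> A = B)"

lemma shattersD: "shatters F A \<Longrightarrow> B \<subseteq> A \<Longrightarrow> \<exists>S\<in>F. S \<inter> A = B"
  by (simp add: shatters_def)

text \<open>Pajor's form of the Sauer--Shelah lemma.\<close>

lemma card_le_card_shattered: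
  assumes "finite P" "F \<subseteq> Pow P"
  shows "card F \<le> card {A. A \<subseteq> P \<and> shatters F A}"
  using assms
proof (induction P arbitrary: F rule: finite_induct)
  case empty
  have "F \<subseteq> {A. A \<subseteq> {} \<and> shatters F A}"
    using empty.prems unfolding shatters_def by blast
  then show ?case
    by (rule card_mono[OF finite_subset[of _ "{{}}"], rotated 2]) auto
next
  case (insert x P)
  \<comment> \<open>\<open>F0\<close> is the family of traces on \<open>P\<close>; \<open>F1\<close>
    collects the traces that come from two members of \<open>F\<close>, one with \<open>x\<close>
    and one without.\<close>
  define F0 where "F0 = (\<lambda>S. S - {x}) ` F"
  define F1 where "F1 = {S. S \<subseteq> P \<and> S \<in> F \<and> insert x S \<in> F}"
  define Sh where "Sh G = {A. A \<subseteq> P \<and> shatters G A}" for G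
  have finF: "finite F"
    using insert.prems insert.hyps by (meson finite.insertI finite_Pow_iff finite_subset)
  have finP: "finite (Sh G)" for G
    using insert.hyps unfolding Sh_def by simp
  have F_split: "card F = card F0 + card F1"
  proof -
    \<comment> \<open>Discarding the member that contains \<open>x\<close> from each such pair makes
      deletion of \<open>x\<close> injective without losing any trace.\<close>
    let ?B = "{S \<in> F. x \<in> S \<and> S - {x} \<in> F}"
    have bij1: "card ?B = card F1"
    proof (rule bij_betw_same_card)
      have "S - {x} = S" if "S \<subseteq> P" for S using that insert.hyps(2) by blast
      then show "bij_betw (\<lambda>S. S - {x}) ?B F1"
        using insert.prems
        by (intro bij_betwI[where g = "insert x"]) (use insert.hyps(2) in \<open>auto simp: F1_def insert_absorb\<close>)
    qed
    have bij2: "card (F - ?B) = card F0"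
    proof (rule bij_betw_same_card)
      have "inj_on (\<lambda>S. S - {x}) (F - ?B)"
      proof (rule inj_onI)
        fix S T assume st: "S \<in> F - ?B" "T \<in> F - ?B" "S - {x} = T - {x}"
        show "S = T"
        proof (cases "x \<in> S"; cases "x \<in> T")
          assume "x \<in> S" "x \<notin> T"
          then show ?thesis using st by auto
        next
          assume "x \<notin> S" "x \<in> T"
          then show ?thesis using st by auto
        qed (use st in blast)+
      qed
      moreover have "(\<lambda>S. S - {x}) ` (F - ?B) = F0"
        unfolding F0_def
      proof (intro subset_antisym subsetI)
        fix U assume "U \<in> (\<lambda>S. S - {x}) ` F"
        then obtain S where S: "S \<in> F" "U = S - {x}" by blast
        show "U \<in> (\<lambda>S. S - {x}) ` (F - ?B)"
        proof (cases "S \<in> ?B")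
          case True
          then have "U \<in> F - ?B" "U = U - {x}" using S by auto
          then show ?thesis by blast
        qed (use S in blast)
      qed blast
      ultimately show "bij_betw (\<lambda>S. S - {x}) (F - ?B) F0"
        by (simp add: bij_betw_def)
    qed
    have "card (F - ?B) + card ?B = card F"
      using finF card_mono[of F ?B] by (subst card_Diff_subset) auto
    then show ?thesis using bij1 bij2 by simp
  qed
  have IH0: "card F0 \<le> card (Sh F0)"
    unfolding Sh_def using insert.prems by (intro insert.IH) (auto simp: F0_def)
  have IH1: "card F1 \<le> card (Sh F1)"
    unfolding Sh_def by (intro insert.IH) (auto simp: F1_def)
  have sub0: "shatters F A" if "A \<in> Sh F0" for A
    unfolding shatters_def
  proof (intro allI impI)
    fix B assume "B \<subseteq> A"
    moreover have "shatters F0 A" using that by (simp add: Sh_def)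
    ultimately obtain S where "S \<in> F" "(S - {x}) \<inter> A = B"
      using shattersD[of F0 A B] unfolding F0_def by blast
    moreover have "x \<notin> A" using that insert.hyps(2) by (auto simp: Sh_def)
    ultimately show "\<exists>S\<in>F. S \<inter> A = B" by blast
  qed
  \<comment> \<open>Both a member of \<open>F1\<close> and its extension by \<open>x\<close> lie in
    \<open>F\<close>, so \<open>x\<close> can be added to any set that \<open>F1\<close>
    shatters.\<close>
  have sub1: "shatters F (insert x A)" if A: "A \<in> Sh F1" for A
    unfolding shatters_def
  proof (intro allI impI)
    fix B assume B: "B \<subseteq> insert x A"
    have "shatters F1 A" "B - {x} \<subseteq> A" using A B by (auto simp: Sh_def)
    then have "\<exists>S\<in>F1. S \<inter> A = B - {x}" by (rule shattersD)
    then obtain S where S: "S \<subseteq> P" "S \<in> F" "insert x S \<in> F" "S \<inter> A = B - {x}"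
      unfolding F1_def by blast
    have "x \<notin> S" using S(1) insert.hyps(2) by blast
    show "\<exists>S\<in>F. S \<inter> insert x A = B"
    proof (cases "x \<in> B")
      case True
      then have "insert x S \<inter> insert x A = B" using S(4) by auto
      then show ?thesis using S(3) by blast
    next
      case False
      then have "S \<inter> insert x A = B" using S(4) \<open>x \<notin> S\<close> by auto
      then show ?thesis using S(2) by blast
    qed
  qed
  have inj: "inj_on (insert x) (Sh F1)"
    using insert.hyps(2) by (intro inj_onI) (auto simp: Sh_def)
  have "card F \<le> card (Sh F0) + card (insert x ` Sh F1)"
    using F_split IH0 IH1 card_image[OF inj] by simp
  \<comment> \<open>No set is counted twice: \<open>x\<close> is in every set of the second family
    and in none of the first.\<close>
  also have "\<dots> = card (Sh F0 \<union> insert x ` Sh F1)"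
    using finP insert.hyps(2) by (intro card_Un_disjoint[symmetric]) (auto simp: Sh_def)
  also have "\<dots> \<le> card {A. A \<subseteq> insert x P \<and> shatters F A}"
  proof (rule card_mono)
    show "finite {A. A \<subseteq> insert x P \<and> shatters F A}"
      using insert.hyps(1) by simp
    show "Sh F0 \<union> insert x ` Sh F1 \<subseteq> {A. A \<subseteq> insert x P \<and> shatters F A}"
      using sub0 sub1 by (auto simp: Sh_def)
  qed
  finally show ?case .
qed

text \<open>Induction on \<open>k\<close>: a nonempty set of size at most \<open>k + 1\<close>
  arises by inserting one of its points into a set of size at most \<open>k\<close>. The extra
  choice \<open>None\<close>, inserting nothing, accounts for the empty set and for the
  \<open>+ 1\<close> in the base.\<close>

lemma card_bounded_subsets_le:
  assumes "finite P"
  shows "card {A. A \<subseteq> P \<and> card A \<le> k} \<le> (card P + 1) ^ k"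
proof (induction k)
  case 0
  have "{A. A \<subseteq> P \<and> card A \<le> 0} = {{}}"
    using assms by (auto simp: finite_subset)
  then show ?case by simp
next
  case (Suc k)
  let ?S = "\<lambda>k. {A. A \<subseteq> P \<and> card A \<le> k}"
  let ?f = "\<lambda>(a, A). case a of None \<Rightarrow> A | Some x \<Rightarrow> insert x A"
  have "?S (Suc k) \<subseteq> ?f ` (insert None (Some ` P) \<times> ?S k)"
  proof
    fix A assume A: "A \<in> ?S (Suc k)"
    show "A \<in> ?f ` (insert None (Some ` P) \<times> ?S k)"
    proof (cases "A = {}")
      case True
      then have "A = ?f (None, {})" by simp
      moreover have "(None, {}) \<in> insert None (Some ` P) \<times> ?S k" by simp
      ultimately show ?thesis by blast
    next
      case False
      then obtain x where x: "x \<in> A" by blast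
      have "finite A" using A assms finite_subset by blast
      then have "(Some x, A - {x}) \<in> insert None (Some ` P) \<times> ?S k"
        using A x by auto
      moreover have "A = ?f (Some x, A - {x})" using x by auto
      ultimately show ?thesis by blast
    qed
  qed
  moreover have fin: "finite (insert None (Some ` P) \<times> ?S k)"
    using assms by simp
  ultimately have "card (?S (Suc k)) \<le> card (insert None (Some ` P) \<times> ?S k)"
    by (meson surj_card_le)
  also have "\<dots> = (card P + 1) * card (?S k)"
    using assms by (simp add: card_cartesian_product card_image)
  also have "\<dots> \<le> (card P + 1) ^ Suc k"
    using mult_left_mono[OF Suc.IH, of "card P + 1"] by simp
  finally show ?case .
qed

section \<open>Halfspaces and their traces on a finite set\<close>

text \<open>Taking \<open>a = 0\<close> makes \<open>{}\<close> and \<open>UNIV\<close> halfspaces.\<close>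

definition halfspace :: "'a::real_inner set \<Rightarrow> bool" where
  "halfspace H \<longleftrightarrow> (\<exists>a b. H = {x. a \<bullet> x \<le> b})"

lemma halfspace_empty: "halfspace {}"
  unfolding halfspace_def by (rule exI[of _ 0], rule exI[of _ "-1"]) simp

lemma halfspace_UNIV: "halfspace UNIV"
  unfolding halfspace_def by (rule exI[of _ 0], rule exI[of _ 0]) simp

lemma halfspace_imp_convex: "halfspace H \<Longrightarrow> convex H"
  unfolding halfspace_def using convex_halfspace_le by blast

lemma halfspace_imp_closed: "halfspace H \<Longrightarrow> closed H"
  unfolding halfspace_def using closed_halfspace_le by blast

lemma halfspace_imp_convex_Compl:
  assumes "halfspace H" shows "convex (- H)"
proof -
  obtain a b where "H = {x. a \<bullet> x \<le> b}" using assms unfolding halfspace_def by blast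
  then have "- H = {x. a \<bullet> x > b}" by auto
  then show ?thesis by (simp add: convex_halfspace_gt)
qed

text \<open>Among more than \<open>DIM('a) + 1\<close> points, Radon's theorem finds two disjoint
  sets with meeting hulls. A halfspace that contains one set and misses the other would separate the
  hulls, since both it and its complement are convex.\<close>

lemma card_halfspace_shattered_le:
  fixes A :: "'a::euclidean_space set"
  assumes "finite A" and sh: "shatters ((\<lambda>H. P \<inter> H) ` Collect halfspace) A"
  shows "card A \<le> DIM('a) + 1"
proof (rule ccontr)
  assume "\<not> ?thesis"
  then have "affine_dependent A"
    using assms(1) by (intro affine_dependent_biggerset) auto
  then obtain M N where MN: "M \<subseteq> A" "N \<subseteq> A" "M \<inter> N = {}" "convex hull M \<inter> convex hull N \<noteq> {}"
    by (rule Radon)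
  from shattersD[OF sh MN(1)] obtain H where H: "halfspace H" "P \<inter> H \<inter> A = M"
    by blast
  \<comment> \<open>The trace that cuts out all of \<open>A\<close> forces
    \<open>A \<subseteq> P\<close>, so intersecting with \<open>P\<close> loses no point of
    \<open>A\<close>.\<close>
  from shattersD[OF sh order_refl] have "A \<subseteq> P" by blast
  then have "M \<subseteq> H" "N \<subseteq> - H" using H MN by blast+
  then have "convex hull M \<subseteq> H" "convex hull N \<subseteq> - H"
    using halfspace_imp_convex[OF H(1)] halfspace_imp_convex_Compl[OF H(1)]
    by (simp_all add: hull_minimal)
  then show False using MN(4) by blast
qed

lemma card_halfspace_traces_le:
  fixes P :: "'a::euclidean_space set"
  assumes "finite P"
  shows "card ((\<lambda>H. P \<inter> H) ` Collect halfspace) \<le> (card P + 1) ^ (DIM('a) + 1)"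
proof -
  let ?F = "(\<lambda>H. P \<inter> H) ` Collect halfspace"
  have "card ?F \<le> card {A. A \<subseteq> P \<and> shatters ?F A}"
    using assms by (intro card_le_card_shattered) auto
  also have "\<dots> \<le> card {A. A \<subseteq> P \<and> card A \<le> DIM('a) + 1}"
    using assms card_halfspace_shattered_le finite_subset
    by (intro card_mono) (simp, blast)
  also have "\<dots> \<le> (card P + 1) ^ (DIM('a) + 1)"
    by (rule card_bounded_subsets_le[OF assms])
  finally show ?thesis .
qed

section \<open>Separation and Helly's theorem\<close>

text \<open>The sets are replaced by halfspaces one at a time. \<open>L\<close> carries the
  halfspaces chosen so far, which is why it is only assumed closed and convex, not compact.\<close>

lemma separating_halfspaces_aux:
  fixes D :: "'i \<Rightarrow> 'a::euclidean_space set"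
  assumes "finite G" "closed L" "convex L"
    and "\<And>x. x \<in> G \<Longrightarrow> compact (D x) \<and> convex (D x)"
    and "L \<inter> (\<Inter>x\<in>G. D x) = {}"
  shows "\<exists>H. (\<forall>x\<in>G. halfspace (H x) \<and> D x \<subseteq> H x) \<and> L \<inter> (\<Inter>x\<in>G. H x) = {}"
  using assms
proof (induction G arbitrary: L rule: finite_induct)
  case (insert x G)
  let ?K = "L \<inter> (\<Inter>y\<in>G. D y)"
  have K: "closed ?K" "convex ?K"
    using insert.prems
    by (intro closed_Int convex_Int closed_INT convex_INT; simp add: compact_imp_closed)+
  have "\<exists>H. halfspace H \<and> D x \<subseteq> H \<and> H \<inter> ?K = {}"
  proof (cases "D x = {}")
    case True
    then show ?thesis using halfspace_empty by blast
  next
    case False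
    then obtain a b where ab: "\<forall>y\<in>D x. a \<bullet> y < b" "\<forall>y\<in>?K. a \<bullet> y > b"
      using separating_hyperplane_compact_closed[of "D x" ?K] insert.prems(3)[of x] insert.prems(4) K
      by (auto simp: Int_left_commute)
    show ?thesis
    proof (intro exI conjI)
      show "halfspace {y. a \<bullet> y \<le> b}" unfolding halfspace_def by blast
    qed (use ab in force)+
  qed
  then obtain Hx where Hx: "halfspace Hx" "D x \<subseteq> Hx" "Hx \<inter> ?K = {}" by blast
  have "\<exists>H. (\<forall>x\<in>G. halfspace (H x) \<and> D x \<subseteq> H x) \<and> (L \<inter> Hx) \<inter> (\<Inter>x\<in>G. H x) = {}"
    using insert.prems Hx halfspace_imp_closed[OF Hx(1)] halfspace_imp_convex[OF Hx(1)]
    by (intro insert.IH) (auto intro: closed_Int convex_Int)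
  then obtain H where H: "\<forall>x\<in>G. halfspace (H x) \<and> D x \<subseteq> H x"
    "(L \<inter> Hx) \<inter> (\<Inter>x\<in>G. H x) = {}" by blast
  have "(\<forall>y\<in>insert x G. halfspace ((H(x := Hx)) y) \<and> D y \<subseteq> (H(x := Hx)) y)"
    using H(1) Hx by simp
  moreover have "(\<Inter>y\<in>G. (H(x := Hx)) y) = (\<Inter>y\<in>G. H y)"
    using insert.hyps(2) by (intro INF_cong) auto
  then have "L \<inter> (\<Inter>y\<in>insert x G. (H(x := Hx)) y) = {}"
    using H(2) by (metis INF_insert Int_assoc fun_upd_same)
  ultimately show ?case by blast
qed auto

lemma separating_halfspaces:
  fixes D :: "'i \<Rightarrow> 'a::euclidean_space set"
  assumes "finite G" and "\<And>x. x \<in> G \<Longrightarrow> compact (D x) \<and> convex (D x)"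
    and "(\<Inter>x\<in>G. D x) = {}"
  shows "\<exists>H. (\<forall>x\<in>G. halfspace (H x) \<and> D x \<subseteq> H x) \<and> (\<Inter>x\<in>G. H x) = {}"
  using separating_halfspaces_aux[of G UNIV D] assms by simp

text \<open>Helly's theorem speaks of a set of sets, whereas \<open>D\<close> may repeat values.
  Picking one index for each set found turns the bound on sets into one on indices.\<close>

lemma Helly_indexed:
  fixes D :: "'i \<Rightarrow> 'a::euclidean_space set"
  assumes "finite I" "\<And>i. i \<in> I \<Longrightarrow> convex (D i)" "(\<Inter>i\<in>I. D i) = {}"
  obtains G where "G \<subseteq> I" "card G \<le> DIM('a) + 1" "(\<Inter>i\<in>G. D i) = {}"
proof -
  have "\<exists>T\<subseteq>D ` I. card T \<le> DIM('a) + 1 \<and> \<Inter>T = {}"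
  proof (cases "card (D ` I) \<ge> DIM('a) + 1")
    case True
    show ?thesis
    proof (rule ccontr)
      assume "\<not> ?thesis"
      then have "\<Inter>(D ` I) \<noteq> {}"
        using assms(2) by (intro Helly[OF True]) auto
      then show False using assms(3) by simp
    qed
  next
    case False
    then show ?thesis using assms(3) by (intro exI[of _ "D ` I"]) auto
  qed
  then obtain T where T: "T \<subseteq> D ` I" "card T \<le> DIM('a) + 1" "\<Inter>T = {}" by blast
  obtain G where "G \<subseteq> I" "T = D ` G" "inj_on D G"
    using T(1) subset_image_inj[of T D I] by blast
  with T that show ?thesis by (simp add: card_image)
qed

section \<open>Counting colourings by certificates\<close>

text \<open>In \<open>large\<close>, the base \<open>(card P + 1) ^ (CARD('d) + 1)\<close> bounds
  the number of halfspace traces on \<open>P\<close>, its exponent the number of halfspaces in a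
  certificate, and \<open>(r - 1) ^ card P\<close> the colourings sharing one certificate;
  \<open>r ^ card P\<close> counts all colourings.\<close>

lemma has_forcing_partition_if_large:
  fixes P :: "(real ^ 'd::finite) set"
  assumes fin: "finite P"
    and large: "((card P + 1) ^ (CARD('d) + 1)) ^ ((CARD('d) + 1) * (r * s + 1) ^ (CARD('d) + 1))
                  * (r - 1) ^ card P < r ^ card P"
  shows "has_forcing_partition r (\<lambda>_. s) P"
proof (rule ccontr)
  assume no: "\<not> has_forcing_partition r (\<lambda>_. s) P"
  define k where "k = CARD('d) + 1"
  define X where "X = {1..r} \<times> {1..s}"
  \<comment> \<open>Index sets of the subfamilies that Helly may return, independent of the
    colouring. \<open>T\<close> has one slot for each member of each of them, to hold the trace of
    its halfspace.\<close>
  define \<G> where "\<G> = {G. G \<subseteq> X \<and> card G \<le> k}"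
  define T where "T = Sigma \<G> (\<lambda>G. G)"
  define traces where "traces = (\<lambda>H. P \<inter> H) ` Collect halfspace"
  \<comment> \<open>\<open>U h i\<close> stands in for the union of the pieces of colour
    \<open>i\<close>: piece \<open>j\<close> becomes the set of points of \<open>P\<close> lying in
    all traces recorded for it.\<close>
  define U where "U h i = {p \<in> P. \<exists>j\<in>{1..s}. \<forall>G\<in>\<G>. (i, j) \<in> G \<longrightarrow> p \<in> h (G, (i, j))}"
    for h :: "(nat \<times> nat) set \<times> nat \<times> nat \<Rightarrow> (real ^ 'd) set" and i
  \<comment> \<open>\<open>W\<close> holds the valid certificates: no point of \<open>P\<close> is
    in all \<open>U h i\<close>. A colouring fits \<open>h\<close> if each point lies in the
    \<open>U h i\<close> of its own colour.\<close>
  define W where "W = {h \<in> T \<rightarrow>\<^sub>E traces. \<forall>p\<in>P. \<exists>i\<in>{1..r}. p \<notin> U h i}"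
  define colourings where "colourings h = PiE P (\<lambda>p. {i \<in> {1..r}. p \<in> U h i})" for h
  have finX: "finite X" by (simp add: X_def)
  have finG: "finite G" if "G \<in> \<G>" for G
    using that finX finite_subset by (auto simp: \<G>_def)
  have fin\<G>: "finite \<G>"
    using finX by (simp add: \<G>_def)
  have finT: "finite T"
    using fin\<G> finG by (simp add: T_def)
  have fintr: "finite traces"
    using fin by (intro finite_subset[of traces "Pow P"]) (auto simp: traces_def)
  have finW: "finite W"
    unfolding W_def using finT fintr by (simp add: finite_PiE)

  \<comment> \<open>By assumption no colouring is forcing, so each one has a counterexample from
    which a certificate can be read off.\<close>
  have cover: "(P \<rightarrow>\<^sub>E {1..r}) \<subseteq> (\<Union>h\<in>W. colourings h)"
  proof
    fix f assume f: "f \<in> P \<rightarrow>\<^sub>E {1..r}"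
    define Q where "Q i = {p \<in> P. f p = i}" for i
    have "P = (\<Union>i\<in>{1..r}. Q i)" "disjoint_family_on Q {1..r}"
      using f by (auto simp: Q_def disjoint_family_on_def)
    with no have "\<not> forces_intersection r (\<lambda>_. s) Q"
      unfolding has_forcing_partition_def by blast
    then obtain C :: "nat \<Rightarrow> nat \<Rightarrow> (real ^ 'd) set" where
      C: "\<forall>i\<in>{1..r}. (\<forall>j\<in>{1..s}. convex (C i j)) \<and> disjoint_family_on (C i) {1..s} \<and>
                     Q i \<subseteq> (\<Union>j\<in>{1..s}. C i j)" and
      disjC: "(\<Inter>i\<in>{1..r}. \<Union>j\<in>{1..s}. C i j) = {}"
      unfolding forces_intersection_def by blast
    have convC: "convex (C i j)" if "i \<in> {1..r}" "j \<in> {1..s}" for i j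
      using C that by blast
    have coverC: "Q i \<subseteq> (\<Union>j\<in>{1..s}. C i j)" if "i \<in> {1..r}" for i
      using C that by blast
    \<comment> \<open>Hulls of finitely many points are compact, as the separation requires, and
      still lie in the original convex sets.\<close>
    define D where "D x = convex hull (Q (fst x) \<inter> C (fst x) (snd x))" for x
    have D: "compact (D x)" "convex (D x)" for x
      using fin by (auto simp: D_def Q_def finite_imp_compact_convex_hull)
    have D_sub: "D x \<subseteq> C (fst x) (snd x)" if "x \<in> X" for x
      unfolding D_def using that convC by (intro hull_minimal) (auto simp: X_def)
    have "\<forall>G\<in>\<G>. \<exists>H. (\<forall>x\<in>G. halfspace (H x) \<and> D x \<subseteq> H x) \<and>
              ((\<Inter>x\<in>G. D x) = {} \<longrightarrow> (\<Inter>x\<in>G. H x) = {})"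
      (is "\<forall>G\<in>\<G>. \<exists>H. ?sep G H")
    proof
      fix G assume "G \<in> \<G>"
      show "\<exists>H. ?sep G H"
      proof (cases "(\<Inter>x\<in>G. D x) = {}")
        case True
        obtain H where "\<forall>x\<in>G. halfspace (H x) \<and> D x \<subseteq> H x" "(\<Inter>x\<in>G. H x) = {}"
          using separating_halfspaces[OF finG[OF \<open>G \<in> \<G>\<close>] _ True] D by auto
        then have "?sep G H" by simp
        then show ?thesis by (rule exI[of _ H])
      next
        case False
        \<comment> \<open>A subfamily with a common point certifies nothing, so its slots hold the
          whole space.\<close>
        then show ?thesis by (intro exI[of _ "\<lambda>_. UNIV"]) (simp add: halfspace_UNIV)
      qed
    qed
    from bchoice[OF this] obtain H where sep: "\<forall>G\<in>\<G>. ?sep G (H G)" by (rule exE)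
    have H: "halfspace (H G x) \<and> D x \<subseteq> H G x" if "G \<in> \<G>" "x \<in> G" for G x
      using bspec[OF sep that(1)] that(2) by simp
    have H_disj: "(\<Inter>x\<in>G. H G x) = {}" if "G \<in> \<G>" "(\<Inter>x\<in>G. D x) = {}" for G
      using bspec[OF sep that(1)] that(2) by simp
    define h where "h = restrict (\<lambda>(G, x). P \<inter> H G x) T"
    have h_eq: "h (G, x) = P \<inter> H G x" if "G \<in> \<G>" "x \<in> G" for G x
      using that by (simp add: h_def T_def)
    have "h \<in> T \<rightarrow>\<^sub>E traces"
    proof (rule PiE_I)
      fix y assume "y \<in> T"
      then obtain G x where y: "y = (G, x)" "G \<in> \<G>" "x \<in> G" unfolding T_def by (rule SigmaE)
      then show "h y \<in> traces"
        using h_eq[OF y(2,3)] H[OF y(2,3)] by (simp add: traces_def)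
    qed (simp add: h_def)
    \<comment> \<open>A point in all \<open>U h i\<close> would select one piece \<open>J i\<close>
      per colour. The hulls of these pieces have no common point, so Helly gives a member of
      \<open>\<G>\<close> whose halfspaces have empty intersection, yet all of them would contain
      \<open>p\<close>.\<close>
    moreover have "\<exists>i\<in>{1..r}. p \<notin> U h i" if "p \<in> P" for p
    proof (rule ccontr)
      assume "\<not> ?thesis"
      then have "\<forall>i\<in>{1..r}. p \<in> U h i" by blast
      then have "\<forall>i\<in>{1..r}. \<exists>j. j \<in> {1..s} \<and> (\<forall>G\<in>\<G>. (i, j) \<in> G \<longrightarrow> p \<in> h (G, (i, j)))"
        by (simp add: U_def Bex_def)
      from bchoice[OF this] obtain J where "\<forall>i\<in>{1..r}. J i \<in> {1..s} \<and>
          (\<forall>G\<in>\<G>. (i, J i) \<in> G \<longrightarrow> p \<in> h (G, (i, J i)))" by (rule exE)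
      then have J: "J i \<in> {1..s}" "\<forall>G\<in>\<G>. (i, J i) \<in> G \<longrightarrow> p \<in> h (G, (i, J i))"
        if "i \<in> {1..r}" for i
        using that by simp_all
      define I where "I = (\<lambda>i. (i, J i)) ` {1..r}"
      have I: "I \<subseteq> X" using J(1) by (auto simp: I_def X_def)
      have "(\<Inter>x\<in>I. D x) \<subseteq> (\<Inter>i\<in>{1..r}. \<Union>j\<in>{1..s}. C i j)"
      proof (intro subsetI INT_I)
        fix y i assume y: "y \<in> (\<Inter>x\<in>I. D x)" and i: "i \<in> {1..r}"
        have iI: "(i, J i) \<in> I" using i by (simp add: I_def)
        have "y \<in> C i (J i)"
          using subsetD[OF D_sub[OF subsetD[OF I iI]] INT_D[OF y iI]] by simp
        then show "y \<in> (\<Union>j\<in>{1..s}. C i j)" by (rule UN_I[OF J(1)[OF i]])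
      qed
      then have "(\<Inter>x\<in>I. D x) = {}" using disjC by simp
      moreover have "finite I" by (simp add: I_def)
      ultimately obtain G where G: "G \<subseteq> I" "card G \<le> k" "(\<Inter>x\<in>G. D x) = {}"
        using Helly_indexed[of I D] D(2) by (auto simp: k_def)
      have G\<G>: "G \<in> \<G>" using G I by (auto simp: \<G>_def)
      have "p \<in> (\<Inter>x\<in>G. H G x)"
      proof
        fix x assume x: "x \<in> G"
        then obtain i where "i \<in> {1..r}" "x = (i, J i)" using G(1) by (auto simp: I_def)
        then have "p \<in> h (G, x)" using J(2) G\<G> x by blast
        then show "p \<in> H G x" using h_eq[OF G\<G> x] by simp
      qed
      then show False using H_disj[OF G\<G> G(3)] by blast
    qed
    ultimately have "h \<in> W" by (simp add: W_def)
    moreover have "f \<in> colourings h"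
      unfolding colourings_def
    proof (rule PiE_I)
      fix p assume p: "p \<in> P"
      then have fp: "f p \<in> {1..r}" "p \<in> Q (f p)" using f by (auto simp: Q_def)
      \<comment> \<open>The piece that covers \<open>p\<close> has \<open>p\<close> in its hull,
        hence in every halfspace chosen around that hull.\<close>
      then obtain j where j: "j \<in> {1..s}" "p \<in> C (f p) j" using coverC by blast
      have "p \<in> D (f p, j)" using fp(2) j(2) by (simp add: D_def hull_inc)
      then have "p \<in> h (G, (f p, j))" if "G \<in> \<G>" "(f p, j) \<in> G" for G
        using h_eq[OF that] H[OF that] p by blast
      then have "p \<in> U h (f p)"
        unfolding U_def using j(1) p by blast
      then show "f p \<in> {i \<in> {1..r}. p \<in> U h i}"
        using fp(1) by simp
    qed (use f in auto)
    ultimately show "f \<in> (\<Union>h\<in>W. colourings h)" by blast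
  qed

  \<comment> \<open>Membership in \<open>W\<close> denies each point of \<open>P\<close> at least
    one colour.\<close>
  have few: "card (colourings h) \<le> (r - 1) ^ card P" if "h \<in> W" for h
  proof -
    have "card {i \<in> {1..r}. p \<in> U h i} \<le> r - 1" if "p \<in> P" for p
    proof -
      obtain i where i: "i \<in> {1..r}" "p \<notin> U h i" using \<open>h \<in> W\<close> \<open>p \<in> P\<close> by (auto simp: W_def)
      then have "card {i \<in> {1..r}. p \<in> U h i} \<le> card ({1..r} - {i})"
        by (intro card_mono) auto
      then show ?thesis using i(1) by simp
    qed
    then have "(\<Prod>p\<in>P. card {i \<in> {1..r}. p \<in> U h i}) \<le> (\<Prod>p\<in>P. r - 1)"
      by (intro prod_mono) auto
    then show ?thesis using fin by (simp add: colourings_def card_PiE)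
  qed
  \<comment> \<open>There are at most \<open>k\<close> slots for each of the at most
    \<open>(r * s + 1) ^ k\<close> members of \<open>\<G>\<close>.\<close>
  have "card T = (\<Sum>G\<in>\<G>. card G)"
    unfolding T_def using fin\<G> finG by (intro card_SigmaI) auto
  also have "\<dots> \<le> card \<G> * k"
    using sum_bounded_above[of \<G> card k] by (simp add: \<G>_def)
  also have "\<dots> \<le> k * (r * s + 1) ^ k"
    using card_bounded_subsets_le[OF finX, of k] by (simp add: \<G>_def X_def)
  finally have T: "card T \<le> k * (r * s + 1) ^ k" .

  have "r ^ card P = card (P \<rightarrow>\<^sub>E {1..r})"
    using fin by (simp add: card_PiE)
  also have "\<dots> \<le> card (\<Union>h\<in>W. colourings h)"
    using cover finW fin by (intro card_mono) (auto simp: colourings_def intro!: finite_PiE)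
  also have "\<dots> \<le> (\<Sum>h\<in>W. card (colourings h))"
    by (rule card_UN_le[OF finW])
  also have "\<dots> \<le> card W * (r - 1) ^ card P"
    using sum_bounded_above[of W "\<lambda>h. card (colourings h)"] few by simp
  also have "\<dots> \<le> card (T \<rightarrow>\<^sub>E traces) * (r - 1) ^ card P"
    using finT fintr by (intro mult_right_mono card_mono) (auto simp: W_def finite_PiE)
  also have "card (T \<rightarrow>\<^sub>E traces) = card traces ^ card T"
    using finT by (simp add: card_PiE)
  also have "card traces ^ card T \<le> ((card P + 1) ^ k) ^ card T"
    using card_halfspace_traces_le[OF fin] by (intro power_mono) (simp_all add: traces_def k_def)
  also have "\<dots> \<le> ((card P + 1) ^ k) ^ (k * (r * s + 1) ^ k)"
    using T by (intro power_increasing) auto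
  finally show False using large by (simp add: k_def)
qed

section \<open>Asymptotic comparison and exponents\<close>

text \<open>After taking logarithms the certificates contribute order
  \<open>s ^ (d + 1) * ln s\<close>, while passing from \<open>r - 1\<close> to \<open>r\<close>
  colours gains a positive constant times \<open>s ^ (d + 2)\<close>.\<close>

lemma eventually_forcing_inequality:
  fixes A d r :: nat
  assumes "r \<ge> 2"
  shows "eventually (\<lambda>s::nat. ((s ^ (d + 2) + 1) ^ (d + 1)) ^ (A * s ^ (d + 1)) * (r - 1) ^ (s ^ (d + 2))
           < r ^ (s ^ (d + 2))) at_top"
proof -
  \<comment> \<open>\<open>\<kappa>\<close> is the logarithmic gain per point. \<open>B\<close>
    collects the constants of the certificate term, its last factor coming from
    \<open>ln (s ^ (d + 2) + 1) \<le> (d + 2) * ln (s + 1)\<close>.\<close>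
  define \<kappa> where "\<kappa> = ln (real r) - ln (real (r - 1))"
  define B where "B = real A * real (d + 1) * real (d + 2)"
  have "\<kappa> > 0" using assms by (simp add: \<kappa>_def)
  then have "eventually (\<lambda>s::nat. B * ln (real s + 1) < \<kappa> * real s) at_top"
    by real_asymp
  moreover have "eventually (\<lambda>s::nat. s \<ge> 1) at_top"
    by (rule eventually_ge_at_top)
  ultimately show ?thesis
  proof eventually_elim
    case (elim s)
    let ?n = "s ^ (d + 2)"
    let ?l = "((?n + 1) ^ (d + 1)) ^ (A * s ^ (d + 1)) * (r - 1) ^ ?n"
    have "real ?n + 1 \<le> (real s + 1) ^ (d + 2)"
    proof (induction d)
      case (Suc d)
      have "real s ^ (Suc d + 2) + 1 \<le> (real s + 1) * (real s ^ (d + 2) + 1)"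
        by (simp add: algebra_simps)
      also have "\<dots> \<le> (real s + 1) * (real s + 1) ^ (d + 2)"
        using Suc.IH by (intro mult_left_mono) auto
      finally show ?case by simp
    qed (simp add: power2_eq_square algebra_simps)
    then have "ln (real ?n + 1) \<le> ln ((real s + 1) ^ (d + 2))"
      by (intro ln_mono) (auto intro: add_nonneg_pos)
    then have n: "ln (real ?n + 1) \<le> real (d + 2) * ln (real s + 1)"
      by (simp only: ln_realpow)
    have pos: "real ?n + 1 > 0"
      by (auto intro: add_nonneg_pos)
    have ln_pow: "ln ((y ^ a) ^ m * q ^ n) = real m * (real a * ln y) + real n * ln q"
      if "y > 0" "q > 0" for y q :: real and a m n :: nat
      using that by (simp add: ln_mult ln_realpow)
    have "real ?l = ((real ?n + 1) ^ (d + 1)) ^ (A * s ^ (d + 1)) * real (r - 1) ^ ?n"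
      by (simp only: of_nat_mult of_nat_power of_nat_add of_nat_1)
    also have "ln \<dots> = real (A * s ^ (d + 1)) * (real (d + 1) * ln (real ?n + 1))
                       + real ?n * ln (real (r - 1))"
      using pos assms by (intro ln_pow) auto
    also have "\<dots> \<le> real (A * s ^ (d + 1)) * (real (d + 1) * (real (d + 2) * ln (real s + 1)))
                       + real ?n * ln (real (r - 1))"
      using n by (intro add_right_mono mult_left_mono) auto
    also have "\<dots> = real s ^ (d + 1) * (B * ln (real s + 1)) + real ?n * ln (real (r - 1))"
      by (simp add: B_def)
    also have "\<dots> < real s ^ (d + 1) * (\<kappa> * real s) + real ?n * ln (real (r - 1))"
      using elim by (intro add_strict_right_mono mult_strict_left_mono) auto
    also have "\<dots> = real ?n * ln (real r)"
      by (simp add: \<kappa>_def algebra_simps)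
    also have "\<dots> = ln (real (r ^ ?n))"
      using assms by (simp add: ln_realpow)
    finally have "ln (real ?l) < ln (real (r ^ ?n))" .
    moreover have "?l > 0"
      using assms by (intro mult_pos_pos zero_less_power) simp_all
    moreover have "r ^ ?n > 0"
      using assms by simp
    ultimately show ?case
      by (simp only: ln_less_cancel_iff of_nat_0_less_iff of_nat_less_iff)
  qed
qed

text \<open>The exponent does not decrease with \<open>r\<close>, so \<open>r = d + 2\<close> is the
  worst case. There the deficit \<open>(d + 2) / (2 ^ d * (d + 1))\<close> is at most 1, because
  \<open>2 \<le> 2 ^ d\<close>, and the summand \<open>+ 1\<close> absorbs it.\<close>

lemma power_le_powr_exponent:
  fixes d r s :: nat
  assumes "d \<ge> 1" "r \<ge> d + 2" "s \<ge> 1"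
  shows "real s ^ (d + 2) \<le> real s powr ((1 - 1 / (2 ^ d * (real d + 1))) * real r + 1)"
proof -
  let ?\<epsilon> = "1 / (2 ^ d * (real d + 1))"
  have "real d + 2 \<le> 2 * (real d + 1)" by simp
  also have "\<dots> \<le> 2 ^ d * (real d + 1)"
    using power_increasing[of 1 d "2::real"] assms(1) by (intro mult_right_mono) auto
  finally have "(real d + 2) * ?\<epsilon> \<le> 1"
    by (simp add: divide_simps)
  then have "real d + 2 \<le> (1 - ?\<epsilon>) * (real d + 2) + 1"
    by (simp add: algebra_simps)
  also have "\<dots> \<le> (1 - ?\<epsilon>) * real r + 1"
  proof -
    have "2 ^ d * (real d + 1) \<ge> 1 * 1" by (intro mult_mono) auto
    then have "?\<epsilon> \<le> 1" by (simp add: divide_simps)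
    then show ?thesis using assms(2) by (intro add_right_mono mult_left_mono) auto
  qed
  finally have "real s powr (real (d + 2)) \<le> real s powr ((1 - ?\<epsilon>) * real r + 1)"
    using assms(3) by (intro powr_mono) auto
  then show ?thesis using assms(3) by (subst (asm) powr_realpow) auto
qed

section \<open>The bound on \<open>F_number\<close>\<close>

theorem theorem1p7:
  fixes r :: nat
  assumes "r \<ge> CARD('d::finite) + 2"
  shows "\<exists>c>0. \<exists>s0::nat. \<forall>s\<ge>s0.
           ereal_of_enat (F_number TYPE('d) r (\<lambda>_. s)) \<le>
           ereal (c * min (real s powr ((1 - 1 / (2 ^ CARD('d) * (real CARD('d) + 1))) * real r + 1))
                          (real s ^ (2 * CARD('d) + 3)))"
proof -
  define d where "d = CARD('d)"
  \<comment> \<open>\<open>A\<close> comes from \<open>r * s + 1 \<le> (r + 1) * s\<close> for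
    \<open>s \<ge> 1\<close>, which lets \<open>s ^ (d + 1)\<close> be factored out of the
    certificate size.\<close>
  define A where "A = (d + 1) * (r + 1) ^ (d + 1)"
  have d: "d \<ge> 1" by (simp add: d_def)
  obtain s1 where s1: "\<And>s. s \<ge> s1 \<Longrightarrow>
      ((s ^ (d + 2) + 1) ^ (d + 1)) ^ (A * s ^ (d + 1)) * (r - 1) ^ (s ^ (d + 2)) < r ^ (s ^ (d + 2))"
    using eventually_forcing_inequality[of r d A] assms unfolding eventually_at_top_linorder by auto
  have "ereal_of_enat (F_number TYPE('d) r (\<lambda>_. s)) \<le>
      ereal (1 * min (real s powr ((1 - 1 / (2 ^ d * (real d + 1))) * real r + 1))
                     (real s ^ (2 * d + 3)))" if s: "s \<ge> max s1 1" for s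
  proof -
    have "(r * s + 1) ^ (d + 1) \<le> ((r + 1) * s) ^ (d + 1)"
      using s by (intro power_mono) auto
    then have "(d + 1) * (r * s + 1) ^ (d + 1) \<le> A * s ^ (d + 1)"
      unfolding A_def power_mult_distrib mult.assoc by (rule mult_left_mono) simp
    then have "((s ^ (d + 2) + 1) ^ (d + 1)) ^ ((d + 1) * (r * s + 1) ^ (d + 1)) * (r - 1) ^ (s ^ (d + 2))
        \<le> ((s ^ (d + 2) + 1) ^ (d + 1)) ^ (A * s ^ (d + 1)) * (r - 1) ^ (s ^ (d + 2))"
      by (intro mult_right_mono power_increasing one_le_power) auto
    also have "\<dots> < r ^ (s ^ (d + 2))"
      using s1 s by simp
    finally have "has_forcing_partition r (\<lambda>_. s) P"
      if "finite P" "card P = s ^ (d + 2)" for P :: "(real ^ 'd) set"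
      using that by (intro has_forcing_partition_if_large) (simp_all only: d_def)
    then have "F_number TYPE('d) r (\<lambda>_. s) \<le> enat (s ^ (d + 2))"
      unfolding F_number_def by (intro Inf_lower) blast
    then have "ereal_of_enat (F_number TYPE('d) r (\<lambda>_. s)) \<le> ereal_of_enat (enat (s ^ (d + 2)))"
      by (simp only: ereal_of_enat_le_iff)
    also have "\<dots> = ereal (real s ^ (d + 2))" by simp
    also have "real s ^ (d + 2) \<le> real s ^ (2 * d + 3)"
      using s by (intro power_increasing) auto
    then have "ereal (real s ^ (d + 2)) \<le>
        ereal (1 * min (real s powr ((1 - 1 / (2 ^ d * (real d + 1))) * real r + 1))
                       (real s ^ (2 * d + 3)))"
      using power_le_powr_exponent[OF d, of r s] assms s by (simp add: d_def)
    finally show ?thesis .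
  qed
  \<comment> \<open>Both terms of the minimum dominate \<open>s ^ (d + 2)\<close>, so the constant
    \<open>c = 1\<close> suffices.\<close>
  then show ?thesis
    unfolding d_def by (intro exI[of _ 1] exI[of _ "max s1 1"] conjI allI impI) auto
qed

end
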